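(* Let $N\ge 2$ be an integer and suppose that $\Lambda$ has finite $dx$ measure. Let $\mathcal{P}$ be the set of all bounded symmetric probability densities on $\Lambda^N$ (i.e. those in $L^\infty(\Lambda^N;d^Nx)$), equipped with the topology induced by $L^\infty(\Lambda^N;d^Nx)$. Let $\mathcal{P}_*$ be the set of those $P\in\mathcal{P}$ such that $P>0$ a.e. and such that for a.e. $x_N$ in some subset $B\subset\Lambda$ of positive $dx$ measure (depending on $P$), there is a constant $\gamma(x_N)>0$ with $$P(\cdot,x_N)\ge\gamma(x_N)P_{(N-1)}\quad\text{a.e. on }\Lambda^{N-1}.$$ Then $\mathcal{P}_*$ contains an open and dense subset of $\mathcal{P}$.
   Context: $\Lambda$ is a set with a $\sigma$-finite complete measure $dx$, of strictly positive total measure. For $k\ge 1$, $d^kx$ is the completion of the product measure $dx^{\otimes k}$ on $\Lambda^k$; "a.e." on $\Lambda^k$ refers to $d^kx$. A probability density on $\Lambda^N$ is a function $P\in L^1(\Lambda^N;d^Nx)$ with $P\ge 0$ and $\int_{\Lambda^N}P\,d^Nx=1$. For a symmetric probability density $P$ on $\Lambda^N$ with $N\ge 2$, $P_{(N-1)}$ denotes the probability density on $\Lambda^{N-1}$ obtained by integrating $P$ with respect to any one of its variables. *)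

theory Defs
  imports "HOL-Probability.Essential_Supremum"
begin

text \<open>
  Points of the power \<open>\<Lambda>\<^sup>k\<close> of \<open>\<Lambda> = space M\<close> are the
  extensional functions \<open>x \<in> {1..k} \<rightarrow>\<^sub>E space M\<close>, with coordinates
  \<open>x 1, \<dots>, x k\<close>. For \<open>x\<close> in \<open>\<Lambda>\<^bsup>N-1\<^esup>\<close>, the point
  \<open>(x, t)\<close> of \<open>\<Lambda>\<^sup>N\<close> is \<open>x(N := t)\<close>.
\<close>

definition power_measure :: "nat \<Rightarrow> 'a measure \<Rightarrow> (nat \<Rightarrow> 'a) measure" where
  "power_measure k M = completion (PiM {1..k} (\<lambda>_. M))"

text \<open>
  Elements of \<open>L\<^sup>\<infinity>\<close> are represented by functions. The topology is that of the
  essential supremum seminorm; its open sets are closed under almost everywhere equality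
  (lemma \<open>openin_Linf_topology_AE_cong\<close> below), so they are exactly the preimages of the
  open sets of the space of equivalence classes.
\<close>

definition Linf_norm :: "'b measure \<Rightarrow> ('b \<Rightarrow> real) \<Rightarrow> ereal" where
  "Linf_norm M f = esssup M (\<lambda>x. ereal \<bar>f x\<bar>)"

definition Linf_space :: "'b measure \<Rightarrow> ('b \<Rightarrow> real) set" where
  "Linf_space M = {f \<in> borel_measurable M. Linf_norm M f < \<infinity>}"

definition Linf_topology :: "'b measure \<Rightarrow> ('b \<Rightarrow> real) topology" where
  "Linf_topology M = topology (\<lambda>U. U \<subseteq> Linf_space M \<and>
     (\<forall>f\<in>U. \<exists>e>0. \<forall>g\<in>Linf_space M. Linf_norm M (\<lambda>x. g x - f x) < ereal e \<longrightarrow> g \<in> U))"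

lemma openin_Linf_topology:
  "openin (Linf_topology M) U \<longleftrightarrow> U \<subseteq> Linf_space M \<and>
     (\<forall>f\<in>U. \<exists>e>0. \<forall>g\<in>Linf_space M. Linf_norm M (\<lambda>x. g x - f x) < ereal e \<longrightarrow> g \<in> U)"
proof -
  let ?L = "\<lambda>U. U \<subseteq> Linf_space M \<and>
     (\<forall>f\<in>U. \<exists>e>0. \<forall>g\<in>Linf_space M. Linf_norm M (\<lambda>x. g x - f x) < ereal e \<longrightarrow> g \<in> U)"
  have "istopology ?L"
    unfolding istopology_def
  proof (intro conjI allI impI)
    fix S T assume S: "?L S" and T: "?L T"
    show "S \<inter> T \<subseteq> Linf_space M" using S by blast
    show "\<forall>f\<in>S \<inter> T. \<exists>e>0. \<forall>g\<in>Linf_space M.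
        Linf_norm M (\<lambda>x. g x - f x) < ereal e \<longrightarrow> g \<in> S \<inter> T"
    proof
      fix f assume f: "f \<in> S \<inter> T"
      obtain d where d: "d > 0"
        "\<forall>g\<in>Linf_space M. Linf_norm M (\<lambda>x. g x - f x) < ereal d \<longrightarrow> g \<in> S"
        using S f by blast
      obtain e where e: "e > 0"
        "\<forall>g\<in>Linf_space M. Linf_norm M (\<lambda>x. g x - f x) < ereal e \<longrightarrow> g \<in> T"
        using T f by blast
      have "Linf_norm M (\<lambda>x. g x - f x) < ereal d \<and> Linf_norm M (\<lambda>x. g x - f x) < ereal e"
        if "Linf_norm M (\<lambda>x. g x - f x) < ereal (min d e)" for g
        using that by (metis ereal_less(1) ereal_min min_less_iff_conj)
      then show "\<exists>e>0. \<forall>g\<in>Linf_space M.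
          Linf_norm M (\<lambda>x. g x - f x) < ereal e \<longrightarrow> g \<in> S \<inter> T"
        using d e by (intro exI[of _ "min d e"]) auto
    qed
  next
    fix K assume K: "\<forall>U\<in>K. ?L U"
    show "\<Union>K \<subseteq> Linf_space M" using K by blast
    show "\<forall>f\<in>\<Union>K. \<exists>e>0. \<forall>g\<in>Linf_space M.
        Linf_norm M (\<lambda>x. g x - f x) < ereal e \<longrightarrow> g \<in> \<Union>K"
      using K by (meson UnionE UnionI)
  qed
  then show ?thesis
    unfolding Linf_topology_def by (simp add: topology_inverse')
qed

lemma topspace_Linf_topology: "topspace (Linf_topology M) = Linf_space M"
proof
  show "topspace (Linf_topology M) \<subseteq> Linf_space M"
    using openin_topspace[of "Linf_topology M"] unfolding openin_Linf_topology by blast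
  have "openin (Linf_topology M) (Linf_space M)"
    by (auto simp: openin_Linf_topology intro: exI[of _ 1])
  then show "Linf_space M \<subseteq> topspace (Linf_topology M)"
    by (rule openin_subset)
qed

lemma openin_Linf_topology_AE_cong:
  assumes U: "openin (Linf_topology M) U" "f \<in> U"
    and g: "g \<in> borel_measurable M" and eq: "AE x in M. f x = g x"
  shows "g \<in> U"
proof -
  have f: "f \<in> Linf_space M" using U openin_subset[OF U(1)]
    by (auto simp: topspace_Linf_topology)
  then have fm: "f \<in> borel_measurable M" by (simp add: Linf_space_def)
  have "Linf_norm M f = Linf_norm M g"
    unfolding Linf_norm_def using eq fm g by (intro esssup_AE_cong) auto
  then have gL: "g \<in> Linf_space M" using f g by (simp add: Linf_space_def)
  have "Linf_norm M (\<lambda>x. g x - f x) \<le> 0"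
    unfolding Linf_norm_def using eq fm g by (intro esssup_I) auto
  then have "Linf_norm M (\<lambda>x. g x - f x) < ereal e" if "e > 0" for e
    using that by (metis ereal_less(2) order_le_less_trans)
  then show ?thesis using U gL by (auto simp: openin_Linf_topology)
qed

definition prob_density :: "nat \<Rightarrow> 'a measure \<Rightarrow> ((nat \<Rightarrow> 'a) \<Rightarrow> real) \<Rightarrow> bool" where
  "prob_density k M P \<longleftrightarrow> integrable (power_measure k M) P \<and>
     (AE x in power_measure k M. 0 \<le> P x) \<and> (\<integral>x. P x \<partial>power_measure k M) = 1"

definition symmetric_density :: "nat \<Rightarrow> 'a measure \<Rightarrow> ((nat \<Rightarrow> 'a) \<Rightarrow> real) \<Rightarrow> bool" where
  "symmetric_density k M P \<longleftrightarrow>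
     (\<forall>\<pi>. \<pi> permutes {1..k} \<longrightarrow> (AE x in power_measure k M. P (x \<circ> \<pi>) = P x))"

text \<open>
  For symmetric \<open>P\<close> the choice of the variable integrated out is immaterial; we take the
  last one. For \<open>P\<close> integrable on \<open>\<Lambda>\<^sup>N\<close> and \<open>M\<close> complete and
  \<open>\<sigma>\<close>-finite, Fubini's theorem gives integrability of \<open>\<lambda>t. P (x(N := t))\<close> for
  almost every \<open>x\<close>; on the remaining null set the integral has a junk value.
\<close>

definition marginal :: "nat \<Rightarrow> 'a measure \<Rightarrow> ((nat \<Rightarrow> 'a) \<Rightarrow> real) \<Rightarrow> (nat \<Rightarrow> 'a) \<Rightarrow> real" where
  "marginal N M P x = (\<integral>t. P (x(N := t)) \<partial>M)"

definition bdd_sym_densities :: "nat \<Rightarrow> 'a measure \<Rightarrow> ((nat \<Rightarrow> 'a) \<Rightarrow> real) set" where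
  "bdd_sym_densities N M =
     {P \<in> Linf_space (power_measure N M). prob_density N M P \<and> symmetric_density N M P}"

definition bdd_sym_densities_star :: "nat \<Rightarrow> 'a measure \<Rightarrow> ((nat \<Rightarrow> 'a) \<Rightarrow> real) set" where
  "bdd_sym_densities_star N M =
     {P \<in> bdd_sym_densities N M.
        (AE x in power_measure N M. 0 < P x) \<and>
        (\<exists>B\<in>sets M. 0 < emeasure M B \<and>
           (AE t in M. t \<in> B \<longrightarrow>
              (\<exists>\<gamma>>0. AE x in power_measure (N - 1) M. P (x(N := t)) \<ge> \<gamma> * marginal N M P x)))}"

definition bdd_sym_densities_topology :: "nat \<Rightarrow> 'a measure \<Rightarrow> ((nat \<Rightarrow> 'a) \<Rightarrow> real) topology" where
  "bdd_sym_densities_topology N M =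
     subtopology (Linf_topology (power_measure N M)) (bdd_sym_densities N M)"

end

theory Submission
  imports Defs
begin

text \<open>
  The densities that are bounded below by a positive constant form the required set. Lower
  bounds survive small \<open>L\<^sup>\<infinity>\<close> perturbations, so the set is relatively open; it is dense since
  \<open>(P + d) / (1 + d V)\<close>, with \<open>V\<close> the volume of \<open>\<Lambda>\<^sup>N\<close>, tends to \<open>P\<close> as \<open>d\<close> tends to \<open>0\<close>. If
  \<open>e \<le> P \<le> C\<close>, then the marginal of \<open>P\<close> is at most \<open>C m\<close>, with \<open>m\<close> the volume of \<open>\<Lambda>\<close>, so that
  \<open>\<gamma> = e / (C m)\<close> works with \<open>B = \<Lambda>\<close>.
\<close>

section \<open>Sections of almost-everywhere statements on powers\<close>

text \<open>Fubini applied to indicator functions. Since adjoining a coordinate preserves measure,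
  almost-everywhere statements can be moved to a binary product, where \<open>AE_pair\<close> yields
  sections.\<close>

lemma (in product_sigma_finite) distr_fun_upd_PiM:
  assumes "finite I" "i \<notin> I"
  shows "distr (PiM I M \<Otimes>\<^sub>M M i) (PiM (insert i I) M) (\<lambda>(x, t). x(i := t)) = PiM (insert i I) M"
    (is "?D = ?P")
proof (rule measure_eqI)
  fix A assume "A \<in> sets ?D"
  then have A[measurable]: "A \<in> sets ?P" by simp
  have "emeasure ?D A = (\<integral>\<^sup>+y. indicator A y \<partial>?D)"
    by simp
  also have "\<dots> = (\<integral>\<^sup>+p. indicator A ((\<lambda>(x, t). x(i := t)) p) \<partial>(PiM I M \<Otimes>\<^sub>M M i))"
    by (rule nn_integral_distr) simp_all
  also have "\<dots> = (\<integral>\<^sup>+x. \<integral>\<^sup>+t. indicator A (x(i := t)) \<partial>M i \<partial>PiM I M)"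
    by (subst sigma_finite_measure.nn_integral_fst[OF sigma_finite_measures, symmetric])
       simp_all
  also have "\<dots> = (\<integral>\<^sup>+x. indicator A x \<partial>?P)"
    using assms by (intro product_nn_integral_insert[symmetric]) simp_all
  finally show "emeasure ?D A = emeasure ?P A"
    by simp
qed simp

lemma (in product_sigma_finite) AE_PiM_insert:
  assumes I: "finite I" "i \<notin> I" and Q: "AE x in PiM (insert i I) M. Q x"
  shows "AE x in PiM I M. AE t in M i. Q (x(i := t))"
    and "AE t in M i. AE x in PiM I M. Q (x(i := t))"
proof -
  interpret I: finite_product_sigma_finite M I by standard fact
  interpret A: pair_sigma_finite "PiM I M" "M i"
    by (simp add: pair_sigma_finite.intro I.sigma_finite_measure_axioms sigma_finite_measures)
  interpret B: pair_sigma_finite "M i" "PiM I M" ..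
  have pair: "AE p in PiM I M \<Otimes>\<^sub>M M i. Q ((\<lambda>(x, t). x(i := t)) p)"
    using Q by (intro AE_distrD[OF measurable_add_dim]) (simp only: distr_fun_upd_PiM[OF I])
  show "AE x in PiM I M. AE t in M i. Q (x(i := t))"
    using A.AE_pair[OF pair] by simp
  \<comment> \<open>The swap of the two factors also preserves measure, which gives sections in the
    other order.\<close>
  have "AE p in M i \<Otimes>\<^sub>M PiM I M. Q ((\<lambda>(x, t). x(i := t)) ((\<lambda>(x, y). (y, x)) p))"
    using pair by (intro AE_distrD[OF measurable_pair_swap']) (simp only: flip: A.distr_pair_swap)
  from B.AE_pair[OF this] show "AE t in M i. AE x in PiM I M. Q (x(i := t))"
    by simp
qed

text \<open>A completion has the same almost-everywhere statements as the original measure, so the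
  result for \<open>PiM\<close> carries over. Sections at fixed \<open>x\<close> serve to bound the
  marginal, an integral over \<open>t\<close>; sections at fixed \<open>t\<close> serve the lower
  bound on P(., t).\<close>

lemma AE_power_measure_last:
  assumes M: "sigma_finite_measure M" and N: "N \<ge> 1"
    and Q: "AE x in power_measure N M. Q x"
  shows "AE x in power_measure (N - 1) M. AE t in M. Q (x(N := t))"
    and "AE t in M. AE x in power_measure (N - 1) M. Q (x(N := t))"
proof -
  interpret product_sigma_finite "\<lambda>_::nat. M"
    using M by (simp add: product_sigma_finite_def)
  have "insert N {1..N - 1} = {1..N}"
    using N by auto
  then have Q': "AE x in PiM (insert N {1..N - 1}) (\<lambda>_. M). Q x"
    using Q by (simp only: power_measure_def AE_completion_iff)
  have N': "finite {1..N - 1}" "N \<notin> {1..N - 1}"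
    using N by auto
  show "AE x in power_measure (N - 1) M. AE t in M. Q (x(N := t))"
    and "AE t in M. AE x in power_measure (N - 1) M. Q (x(N := t))"
    using AE_PiM_insert[OF N' Q'] by (simp_all only: power_measure_def AE_completion_iff)
qed

section \<open>Finite volume and the essential supremum norm\<close>

lemma finite_measure_power_measure:
  assumes "finite_measure M"
  shows "finite_measure (power_measure k M)"
proof
  interpret finite_measure M by fact
  interpret finite_product_sigma_finite "\<lambda>_::nat. M" "{1..k}"
    by standard simp
  have "emeasure (power_measure k M) (space (power_measure k M)) = emeasure M (space M) ^ k"
    by (simp add: power_measure_def space_PiM measure_times del: One_nat_def)
  then show "emeasure (power_measure k M) (space (power_measure k M)) \<noteq> \<infinity>"
    by (simp add: power_eq_top_ennreal)
qed

lemma Linf_norm_leI: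
  assumes "f \<in> borel_measurable M" "AE x in M. \<bar>f x\<bar> \<le> c"
  shows "Linf_norm M f \<le> ereal c"
  unfolding Linf_norm_def using assms by (intro esssup_I) auto

lemma AE_abs_le_of_Linf_norm:
  assumes "Linf_norm M f \<le> ereal c"
  shows "AE x in M. \<bar>f x\<bar> \<le> c"
  using esssup_AE[of "\<lambda>x. ereal \<bar>f x\<bar>" M]
proof eventually_elim
  case (elim x)
  then show ?case
    using assms unfolding Linf_norm_def by (metis ereal_less_eq(3) order_trans)
qed

lemma Linf_space_AE_bounded:
  assumes "f \<in> Linf_space M"
  obtains C where "C > 0" "AE x in M. \<bar>f x\<bar> \<le> C"
proof -
  have "Linf_norm M f < \<infinity>"
    using assms by (simp add: Linf_space_def)
  then obtain c where c: "Linf_norm M f \<le> ereal c"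
    by (auto simp: less_PInf_Ex_of_nat intro: less_imp_le)
  \<comment> \<open>The number \<open>c\<close> may fail to be positive, while the bound later
    occurs in the denominator of \<gamma>.\<close>
  have "AE x in M. \<bar>f x\<bar> \<le> max c 1"
    using AE_abs_le_of_Linf_norm[OF c] by eventually_elim simp
  then show thesis
    by (intro that[of "max c 1"]) auto
qed

text \<open>A perturbation of norm less than half the lower bound of \<open>f\<close> leaves the
  other half as a lower bound. The bound varies with \<open>f\<close>, and so does the
  radius.\<close>

lemma openin_Linf_AE_bounded_below:
  "openin (Linf_topology M) {f \<in> Linf_space M. \<exists>e>0. AE x in M. e \<le> f x}"
  unfolding openin_Linf_topology
proof (intro conjI ballI)
  fix f assume "f \<in> {f \<in> Linf_space M. \<exists>e>0. AE x in M. e \<le> f x}"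
  then obtain e where e: "e > 0" "AE x in M. e \<le> f x"
    by blast
  have "AE x in M. e / 2 \<le> g x" if "Linf_norm M (\<lambda>x. g x - f x) < ereal (e / 2)" for g
    using e(2) AE_abs_le_of_Linf_norm[OF less_imp_le[OF that]] by eventually_elim linarith
  then show "\<exists>d>0. \<forall>g\<in>Linf_space M. Linf_norm M (\<lambda>x. g x - f x) < ereal d \<longrightarrow>
      g \<in> {f \<in> Linf_space M. \<exists>e>0. AE x in M. e \<le> f x}"
    using e(1) by (intro exI[of _ "e / 2"]) (auto intro!: exI[of _ "e / 2"])
qed simp

section \<open>Densities bounded below satisfy the marginal condition\<close>

lemma marginal_AE_le:
  assumes M: "finite_measure M" and N: "N \<ge> 1" and C: "0 \<le> C"
    and P: "AE x in power_measure N M. P x \<le> C"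
  shows "AE x in power_measure (N - 1) M. marginal N M P x \<le> C * measure M (space M)"
proof -
  interpret finite_measure M by fact
  show ?thesis
    using AE_power_measure_last(1)[OF sigma_finite_measure_axioms N P]
  proof eventually_elim
    case (elim x)
    show ?case
    proof (cases "integrable M (\<lambda>t. P (x(N := t)))")
      case True
      then have "marginal N M P x \<le> (\<integral>t. C \<partial>M)"
        unfolding marginal_def using elim by (intro integral_mono_AE) auto
      then show ?thesis
        by (simp add: mult.commute)
    \<comment> \<open>On a non-integrable section the integral is 0 by convention, which is at most
      \<open>C * measure M (space M)\<close> because \<open>C\<close> is nonnegative.\<close>
    qed (use C in \<open>simp add: marginal_def not_integrable_integral_eq\<close>)
  qed
qed

lemma bdd_sym_densities_star_AE_bounded_below:
  assumes M: "finite_measure M" "emeasure M (space M) > 0" and N: "N \<ge> 1"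
    and P: "P \<in> bdd_sym_densities N M" and e: "e > 0" "AE x in power_measure N M. e \<le> P x"
  shows "P \<in> bdd_sym_densities_star N M"
proof -
  interpret finite_measure M by fact
  define m where "m = measure M (space M)"
  have m: "m > 0"
    using M(2) by (simp add: m_def emeasure_eq_measure)
  obtain C where C: "C > 0" "AE x in power_measure N M. \<bar>P x\<bar> \<le> C"
    using P Linf_space_AE_bounded by (auto simp: bdd_sym_densities_def)
  have marg: "AE x in power_measure (N - 1) M. marginal N M P x \<le> C * m"
    unfolding m_def using C by (intro marginal_AE_le[OF M(1) N]) auto
  have "AE t in M. AE x in power_measure (N - 1) M. e \<le> P (x(N := t))"
    by (rule AE_power_measure_last(2)[OF sigma_finite_measure_axioms N e(2)])
  then have "AE t in M. AE x in power_measure (N - 1) M. e / (C * m) * marginal N M P x \<le> P (x(N := t))"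
  proof eventually_elim
    case (elim t)
    show ?case
      \<comment> \<open>The null set excluded in \<open>marg\<close> does not depend on
        \<open>t\<close>, so one constant \<gamma> serves almost every \<open>t\<close>.\<close>
      using elim marg
    proof eventually_elim
      case (elim x)
      have "e / (C * m) * marginal N M P x \<le> e / (C * m) * (C * m)"
        using elim e(1) C(1) m by (intro mult_left_mono) auto
      with elim C(1) m show ?case
        by simp
    qed
  qed
  moreover have "e / (C * m) > 0"
    using e(1) C(1) m by simp
  ultimately have "AE t in M. t \<in> space M \<longrightarrow>
      (\<exists>\<gamma>>0. AE x in power_measure (N - 1) M. P (x(N := t)) \<ge> \<gamma> * marginal N M P x)"
    by (auto elim!: eventually_mono)
  moreover have "AE x in power_measure N M. 0 < P x"
    using e(2) by eventually_elim (use e(1) in simp)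
  ultimately show ?thesis
    using P M(2) unfolding bdd_sym_densities_star_def by blast
qed

section \<open>Approximation by densities bounded below\<close>

text \<open>The integral of \<open>P + d\<close> is \<open>1 + d * V\<close>, so the division
  restores total mass 1. Finite volume makes the constant integrable, and an affine change of values
  respects symmetry.\<close>

lemma bdd_sym_densities_shift:
  fixes d :: real
  assumes M: "finite_measure M" and P: "P \<in> bdd_sym_densities N M" and d: "d \<ge> 0"
  defines "V \<equiv> measure (power_measure N M) (space (power_measure N M))"
  shows "(\<lambda>x. (P x + d) / (1 + d * V)) \<in> bdd_sym_densities N M"
proof -
  interpret finite_measure "power_measure N M"
    using M by (rule finite_measure_power_measure)
  have pos: "1 + d * V > 0"
    using d unfolding V_def by (intro add_pos_nonneg) auto
  have Pm[measurable]: "P \<in> borel_measurable (power_measure N M)"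
    using P by (simp add: bdd_sym_densities_def Linf_space_def)
  obtain C where C: "AE x in power_measure N M. \<bar>P x\<bar> \<le> C"
    using P Linf_space_AE_bounded unfolding bdd_sym_densities_def by blast
  have "AE x in power_measure N M. \<bar>(P x + d) / (1 + d * V)\<bar> \<le> (C + d) / (1 + d * V)"
    using C
  proof eventually_elim
    case (elim x)
    then show ?case
      using d pos by (auto simp: abs_divide intro!: divide_right_mono)
  qed
  then have "Linf_norm (power_measure N M) (\<lambda>x. (P x + d) / (1 + d * V)) \<le> ereal ((C + d) / (1 + d * V))"
    by (intro Linf_norm_leI) auto
  then have "(\<lambda>x. (P x + d) / (1 + d * V)) \<in> Linf_space (power_measure N M)"
    unfolding Linf_space_def by (auto intro: le_less_trans)
  moreover have "prob_density N M (\<lambda>x. (P x + d) / (1 + d * V))"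
  proof -
    have I: "integrable (power_measure N M) P" "(\<integral>x. P x \<partial>power_measure N M) = 1"
      and nn: "AE x in power_measure N M. 0 \<le> P x"
      using P by (auto simp: bdd_sym_densities_def prob_density_def)
    have "AE x in power_measure N M. 0 \<le> (P x + d) / (1 + d * V)"
      using nn by eventually_elim (use d pos in auto)
    moreover have "(\<integral>x. (P x + d) / (1 + d * V) \<partial>power_measure N M) = 1"
      using I pos by (simp add: V_def mult.commute)
    ultimately show ?thesis
      using I by (simp add: prob_density_def)
  qed
  moreover have "symmetric_density N M (\<lambda>x. (P x + d) / (1 + d * V))"
    using P by (auto simp: bdd_sym_densities_def symmetric_density_def elim!: eventually_mono)
  ultimately show ?thesis
    by (simp add: bdd_sym_densities_def)
qed

lemma bdd_sym_densities_approx: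
  assumes M: "finite_measure M" and P: "P \<in> bdd_sym_densities N M" and e: "e > 0"
  obtains Q d where "Q \<in> bdd_sym_densities N M" "d > 0" "AE x in power_measure N M. d \<le> Q x"
    "Linf_norm (power_measure N M) (\<lambda>x. Q x - P x) < ereal e"
proof -
  define V where "V = measure (power_measure N M) (space (power_measure N M))"
  have V: "V \<ge> 0" by (simp add: V_def)
  obtain C where C: "C > 0" "AE x in power_measure N M. \<bar>P x\<bar> \<le> C"
    using P Linf_space_AE_bounded by (auto simp: bdd_sym_densities_def)
  \<comment> \<open>Chosen so that the estimate \<open>d * (1 + V * C)\<close> of the distance from
    \<open>Q\<close> to \<open>P\<close> equals \<open>e / 2\<close>, which leaves room for the
    strict inequality.\<close>
  define d where "d = e / (2 * (1 + V * C))"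
  have VC: "1 + V * C > 0"
    using V C(1) by (intro add_pos_nonneg) auto
  have d: "d > 0"
    using e VC by (simp add: d_def)
  have pos: "1 + d * V \<ge> 1"
    using d V by simp
  define Q where "Q = (\<lambda>x. (P x + d) / (1 + d * V))"
  have Q: "Q \<in> bdd_sym_densities N M"
    unfolding Q_def V_def using M P d by (intro bdd_sym_densities_shift) auto
  have [measurable]: "P \<in> borel_measurable (power_measure N M)"
      "Q \<in> borel_measurable (power_measure N M)"
    using P Q by (simp_all add: bdd_sym_densities_def Linf_space_def)
  have "AE x in power_measure N M. 0 \<le> P x"
    using P by (simp add: bdd_sym_densities_def prob_density_def)
  \<comment> \<open>Normalizing also scales the lower bound, so the witness returned for
    \<open>d\<close> is \<open>d / (1 + d * V)\<close>.\<close>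
  then have low: "AE x in power_measure N M. d / (1 + d * V) \<le> Q x"
    unfolding Q_def by eventually_elim (use pos in \<open>auto intro!: divide_right_mono\<close>)
  have "AE x in power_measure N M. \<bar>Q x - P x\<bar> \<le> e / 2"
    using C(2)
  proof eventually_elim
    case (elim x)
    \<comment> \<open>Over the common denominator the terms \<open>P x\<close> cancel and a factor
      \<open>d\<close> comes out; the denominator is at least 1 and can then be dropped.\<close>
    have "Q x - P x = d * (1 - V * P x) / (1 + d * V)"
      using pos by (simp add: Q_def field_simps)
    then have "\<bar>Q x - P x\<bar> = d * \<bar>1 - V * P x\<bar> / (1 + d * V)"
      using pos d by (simp add: abs_mult abs_divide)
    also have "\<dots> \<le> d * \<bar>1 - V * P x\<bar> / 1"
      using pos d by (intro divide_left_mono) auto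
    also have "\<bar>1 - V * P x\<bar> \<le> 1 + V * C"
      using mult_left_mono[OF elim V] abs_triangle_ineq4[of 1 "V * P x"] V by (simp add: abs_mult)
    then have "d * \<bar>1 - V * P x\<bar> / 1 \<le> d * (1 + V * C)"
      using d by simp
    also have "\<dots> = e / 2"
      using VC by (simp add: d_def field_simps)
    finally show ?case .
  qed
  then have "Linf_norm (power_measure N M) (\<lambda>x. Q x - P x) \<le> ereal (e / 2)"
    by (intro Linf_norm_leI) auto
  also have "\<dots> < ereal e"
    using e by simp
  finally show thesis
    using that[OF Q _ low] d pos by simp
qed

section \<open>Openness and density\<close>

theorem theorem15:
  fixes M :: "'a measure" and N :: nat
  assumes "N \<ge> 2"
    and "sigma_finite_measure M"
    and "complete_measure M"
    and "emeasure M (space M) > 0"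
    and "emeasure M (space M) < \<infinity>"
  shows "\<exists>U. U \<subseteq> bdd_sym_densities_star N M \<and>
           openin (bdd_sym_densities_topology N M) U \<and>
           bdd_sym_densities_topology N M closure_of U = bdd_sym_densities N M"
proof -
  have fin: "finite_measure M"
    using assms(5) by (intro finite_measureI) auto
  let ?L = "power_measure N M"
  let ?D = "bdd_sym_densities N M"
  let ?T = "bdd_sym_densities_topology N M"
  \<comment> \<open>The lower bound is an open condition in all of \<open>Linf_space ?L\<close>, so
    its trace on \<open>?D\<close> is relatively open.\<close>
  define U where "U = {f \<in> Linf_space ?L. \<exists>e>0. AE x in ?L. e \<le> f x} \<inter> ?D"
  have "U \<subseteq> bdd_sym_densities_star N M"
    using bdd_sym_densities_star_AE_bounded_below[OF fin assms(4)] assms(1)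
    by (auto simp: U_def)
  moreover have "openin ?T U"
    unfolding U_def bdd_sym_densities_topology_def openin_subtopology
    using openin_Linf_AE_bounded_below by blast
  moreover have "?T closure_of U = ?D"
  proof
    have DL: "?D \<subseteq> Linf_space ?L"
      by (auto simp: bdd_sym_densities_def)
    then have top: "topspace ?T = ?D"
      by (auto simp: bdd_sym_densities_topology_def topspace_Linf_topology)
    then show "?T closure_of U \<subseteq> ?D"
      using closure_of_subset_topspace[of ?T U] by simp
    show "?D \<subseteq> ?T closure_of U"
    proof
      fix P assume P: "P \<in> ?D"
      \<comment> \<open>A relative neighbourhood of \<open>P\<close> is the trace on
        \<open>?D\<close> of an open set containing a ball around \<open>P\<close>; the
        approximating density lies in that ball and in \<open>?D\<close>.\<close>
      have "\<exists>Q. Q \<in> U \<and> Q \<in> W" if "P \<in> W" "openin ?T W" for W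
      proof -
        obtain S where S: "openin (Linf_topology ?L) S" "W = S \<inter> ?D"
          using \<open>openin ?T W\<close> by (auto simp: bdd_sym_densities_topology_def openin_subtopology)
        then obtain e where e: "e > 0"
          "\<And>g. g \<in> Linf_space ?L \<Longrightarrow> Linf_norm ?L (\<lambda>x. g x - P x) < ereal e \<Longrightarrow> g \<in> S"
          using \<open>P \<in> W\<close> unfolding openin_Linf_topology by blast
        obtain Q d where Q: "Q \<in> ?D" "d > 0" "AE x in ?L. d \<le> Q x"
          "Linf_norm ?L (\<lambda>x. Q x - P x) < ereal e"
          using bdd_sym_densities_approx[OF fin P e(1)] .
        then have "Q \<in> U" "Q \<in> W"
          using DL e(2) S(2) by (auto simp: U_def)
        then show ?thesis by blast
      qed
      then show "P \<in> ?T closure_of U"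
        using P top by (auto simp: in_closure_of)
    qed
  qed
  ultimately show ?thesis by blast
qed

end
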